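(* Let $f:\{0,1\}^n\to\{0,1\}$ be a non-constant Boolean function. Then there exists $x\in\{0,1\}^n$ such that $$\mathrm{size}_F^{+}\big(\partial f(x;\cdot)\big)=\mathrm{size}_F^{u}(f)$$ if and only if $f$ is unate.
   Context: Kleene three-valued logic: values $\{0,u,1\}$ ($0,1$ stable, $u$ unstable) with $\neg u=u$; $a\vee b=1$ if some argument is $1$, $0$ if both are $0$, and $u$ otherwise; $a\wedge b=0$ if some argument is $0$, $1$ if both are $1$, and $u$ otherwise. For $x\in\{0,u,1\}^n$, the set of resolutions $R(x)$ is the set of $y\in\{0,1\}^n$ with $y_i=x_i$ whenever $x_i\neq u$. The hazard-free extension $\tilde f:\{0,u,1\}^n\to\{0,u,1\}$ of $f$ is: $\tilde f(x)=b\in\{0,1\}$ if $f(y)=b$ for all $y\in R(x)$, and $\tilde f(x)=u$ otherwise. A De Morgan formula is a tree whose leaves are labeled by input variables and whose internal nodes are $\wedge,\vee$ (fan-in 2) or $\neg$ (fan-in 1); its size is its number of leaves; it is evaluated on ternary inputs using Kleene logic. A formula is hazard-free for $f$ if on every $x\in\{0,u,1\}^n$ it outputs $\tilde f(x)$; $\mathrm{size}_F^u(f)$ is the minimum size of such a formula. For a monotone Boolean function $g$, $\mathrm{size}_F^+(g)$ is the minimum size of a formula without $\neg$ gates computing $g$. Hazard-derivative: for $x,y\in\{0,1\}^n$ let $x+uy\in\{0,u,1\}^n$ have $i$-th coordinate $x_i$ if $y_i=0$ and $u$ if $y_i=1$; $\partial f(x;y)=0$ if $\tilde f(x+uy)=f(x)$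 and $\partial f(x;y)=1$ if $\tilde f(x+uy)=u$. For fixed $x$, $\partial f(x;\cdot)$ is a monotone Boolean function of $y$. $f$ is positive unate in $x_i$ if $f(x)$ with $x_i$ set to $0$ is $\le f(x)$ with $x_i$ set to $1$ for all $x$, negative unate if $\ge$; $f$ is unate if for each $i$ it is positive or negative unate in $x_i$. *)

theory Defs
  imports Main
begin

datatype tern = Zero | Unst | One

fun tneg :: "tern \<Rightarrow> tern" where
  "tneg Zero = One"
| "tneg Unst = Unst"
| "tneg One = Zero"

definition tor :: "tern \<Rightarrow> tern \<Rightarrow> tern" where
  "tor a b = (if a = One \<or> b = One then One else if a = Zero \<and> b = Zero then Zero else Unst)"

definition tand :: "tern \<Rightarrow> tern \<Rightarrow> tern" where
  "tand a b = (if a = Zero \<or> b = Zero then Zero else if a = One \<and> b = One then One else Unst)"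

definition stable :: "bool \<Rightarrow> tern" where
  "stable b = (if b then One else Zero)"

text \<open>Points of $\{0,1\}^n$ and $\{0,u,1\}^n$ are functions from a finite index type
  \<open>'n\<close> with $n$ elements to \<^typ>\<open>bool\<close> and \<^typ>\<open>tern\<close>.\<close>

definition resolutions :: "('n \<Rightarrow> tern) \<Rightarrow> ('n \<Rightarrow> bool) set" where
  "resolutions x = {y. \<forall>i. x i \<noteq> Unst \<longrightarrow> stable (y i) = x i}"

definition hf_ext :: "(('n \<Rightarrow> bool) \<Rightarrow> bool) \<Rightarrow> ('n \<Rightarrow> tern) \<Rightarrow> tern" where
  "hf_ext f x = (if \<forall>y\<in>resolutions x. f y = True then One
                 else if \<forall>y\<in>resolutions x. f y = False then Zero
                 else Unst)"

text \<open>Leaves are input variables only; there are no constant leaves.\<close>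

datatype 'n formula =
    FVar 'n
  | FNot "'n formula"
  | FAnd "'n formula" "'n formula"
  | FOr "'n formula" "'n formula"

primrec leaves :: "'n formula \<Rightarrow> nat" where
  "leaves (FVar i) = 1"
| "leaves (FNot F) = leaves F"
| "leaves (FAnd F G) = leaves F + leaves G"
| "leaves (FOr F G) = leaves F + leaves G"

primrec evalf :: "'n formula \<Rightarrow> ('n \<Rightarrow> tern) \<Rightarrow> tern" where
  "evalf (FVar i) x = x i"
| "evalf (FNot F) x = tneg (evalf F x)"
| "evalf (FAnd F G) x = tand (evalf F x) (evalf G x)"
| "evalf (FOr F G) x = tor (evalf F x) (evalf G x)"

primrec negation_free :: "'n formula \<Rightarrow> bool" where
  "negation_free (FVar i) = True"
| "negation_free (FNot F) = False"
| "negation_free (FAnd F G) = (negation_free F \<and> negation_free G)"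
| "negation_free (FOr F G) = (negation_free F \<and> negation_free G)"

definition computes :: "'n formula \<Rightarrow> (('n \<Rightarrow> bool) \<Rightarrow> bool) \<Rightarrow> bool" where
  "computes F g \<longleftrightarrow> (\<forall>y. evalf F (\<lambda>i. stable (y i)) = stable (g y))"

definition hazard_free_for :: "'n formula \<Rightarrow> (('n \<Rightarrow> bool) \<Rightarrow> bool) \<Rightarrow> bool" where
  "hazard_free_for F f \<longleftrightarrow> (\<forall>x. evalf F x = hf_ext f x)"

text \<open>Since formulas have no constant leaves, the two minima below range over a nonempty
  set exactly when the function is non-constant (and, for \<open>size_F_plus\<close>, monotone);
  otherwise \<^const>\<open>Least\<close> returns an unspecified number.\<close>

definition size_F_u :: "(('n \<Rightarrow> bool) \<Rightarrow> bool) \<Rightarrow> nat" where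
  "size_F_u f = (LEAST s. \<exists>F. hazard_free_for F f \<and> leaves F = s)"

definition size_F_plus :: "(('n \<Rightarrow> bool) \<Rightarrow> bool) \<Rightarrow> nat" where
  "size_F_plus g = (LEAST s. \<exists>F. negation_free F \<and> computes F g \<and> leaves F = s)"

definition perturb :: "('n \<Rightarrow> bool) \<Rightarrow> ('n \<Rightarrow> bool) \<Rightarrow> 'n \<Rightarrow> tern" where
  "perturb x y = (\<lambda>i. if y i then Unst else stable (x i))"

definition hderiv :: "(('n \<Rightarrow> bool) \<Rightarrow> bool) \<Rightarrow> ('n \<Rightarrow> bool) \<Rightarrow> ('n \<Rightarrow> bool) \<Rightarrow> bool" where
  "hderiv f x y \<longleftrightarrow> hf_ext f (perturb x y) = Unst"

text \<open>As \<open>x\<close> itself resolves \<open>perturb x y\<close>, the only other possible value is \<open>f x\<close>.\<close>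

lemma not_hderiv_iff: "\<not> hderiv f x y \<longleftrightarrow> hf_ext f (perturb x y) = stable (f x)"
proof -
  have "x \<in> resolutions (perturb x y)"
    by (simp add: resolutions_def perturb_def)
  then show ?thesis
    by (auto simp: hderiv_def hf_ext_def stable_def)
qed

lemma mono_hderiv: "mono (hderiv f x)"
proof (rule monoI)
  fix y y' :: "'a \<Rightarrow> bool"
  assume "y \<le> y'"
  then have "resolutions (perturb x y) \<subseteq> resolutions (perturb x y')"
    by (auto simp: resolutions_def perturb_def le_fun_def)
  then show "hderiv f x y \<le> hderiv f x y'"
    by (auto simp: hderiv_def hf_ext_def split: if_splits)
qed

definition positive_unate_in :: "(('n \<Rightarrow> bool) \<Rightarrow> bool) \<Rightarrow> 'n \<Rightarrow> bool" where
  "positive_unate_in f i \<longleftrightarrow> (\<forall>x. f (x(i := False)) \<le> f (x(i := True)))"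

definition negative_unate_in :: "(('n \<Rightarrow> bool) \<Rightarrow> bool) \<Rightarrow> 'n \<Rightarrow> bool" where
  "negative_unate_in f i \<longleftrightarrow> (\<forall>x. f (x(i := False)) \<ge> f (x(i := True)))"

definition unate :: "(('n \<Rightarrow> bool) \<Rightarrow> bool) \<Rightarrow> bool" where
  "unate f \<longleftrightarrow> (\<forall>i. positive_unate_in f i \<or> negative_unate_in f i)"

end

theory Submission
  imports Defs
begin

text \<open>Evaluating a formula \<open>F\<close> at \<open>x + uy\<close>, each subformula either keeps its value at \<open>x\<close> or
  becomes unstable, and the set of \<open>y\<close> for which it becomes unstable is described by a
  negation-free formula in \<open>y\<close>. A gate whose inputs agree at \<open>x\<close> turns into a gate of that
  formula, whereas a gate whose inputs differ at \<open>x\<close> discards one of them. So the derivative has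
  at most as many leaves as \<open>F\<close>, and if it has equally many then no gate discards anything; in
  that case \<open>F\<close>, shifted by \<open>x\<close>, computes a monotone function up to complementation, so \<open>f\<close> is
  unate. Conversely, if \<open>f\<close> is unate, shift it by its least point \<open>x\<close> to make it monotone: the
  shift is then the hazard-derivative at \<open>x\<close>, and negation-free formulas are hazard-free.\<close>

section \<open>Boolean values of formulas and their agreement with ternary evaluation\<close>

primrec beval :: "'n formula \<Rightarrow> ('n \<Rightarrow> bool) \<Rightarrow> bool" where
  "beval (FVar i) y = y i"
| "beval (FNot F) y = (\<not> beval F y)"
| "beval (FAnd F G) y = (beval F y \<and> beval G y)"
| "beval (FOr F G) y = (beval F y \<or> beval G y)"

lemma evalf_stable: "evalf F (\<lambda>i. stable (y i)) = stable (beval F y)"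
proof (induction F)
  case (FNot F)
  then show ?case by (cases "beval F y") (simp_all add: stable_def)
qed (simp_all add: stable_def tand_def tor_def)

lemma stable_inject [simp]: "stable a = stable b \<longleftrightarrow> a = b"
  by (simp add: stable_def)

lemma stable_simps [simp]: "stable True = One" "stable False = Zero"
  by (simp_all add: stable_def)

lemma computes_iff_beval: "computes F g \<longleftrightarrow> beval F = g"
  by (auto simp: computes_def evalf_stable)

lemma hf_ext_stable: "hf_ext f (\<lambda>i. stable (y i)) = stable (f y)"
proof -
  have "resolutions (\<lambda>i. stable (y i)) = {y}"
    by (auto simp: resolutions_def stable_def split: if_splits)
  then show ?thesis by (simp add: hf_ext_def stable_def)
qed

lemma hazard_free_for_beval:
  assumes "hazard_free_for F f"
  shows "beval F = f"
proof
  fix y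
  have "evalf F (\<lambda>i. stable (y i)) = hf_ext f (\<lambda>i. stable (y i))"
    using assms by (simp add: hazard_free_for_def)
  then show "beval F y = f y"
    unfolding evalf_stable hf_ext_stable stable_inject .
qed

lemma mono_beval: "negation_free F \<Longrightarrow> mono (beval F)"
  unfolding mono_def le_fun_def le_bool_def by (induction F) auto

section \<open>The derivative of a formula\<close>

text \<open>If both inputs of an AND gate are 1 at \<open>x\<close>, one unstable input suffices; if
  both are 0, both must be unstable; if they differ, only the input that is 0 matters. OR is dual,
  and negation preserves instability.\<close>

primrec deriv_formula :: "('n \<Rightarrow> bool) \<Rightarrow> 'n formula \<Rightarrow> 'n formula" where
  "deriv_formula x (FVar i) = FVar i"
| "deriv_formula x (FNot F) = deriv_formula x F"
| "deriv_formula x (FAnd F G) =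
    (if beval F x = beval G x
     then (if beval F x then FOr else FAnd) (deriv_formula x F) (deriv_formula x G)
     else if beval F x then deriv_formula x G else deriv_formula x F)"
| "deriv_formula x (FOr F G) =
    (if beval F x = beval G x
     then (if beval F x then FAnd else FOr) (deriv_formula x F) (deriv_formula x G)
     else if beval F x then deriv_formula x F else deriv_formula x G)"

lemma negation_free_deriv_formula: "negation_free (deriv_formula x F)"
  by (induction F) auto

lemma leaves_deriv_formula_le: "leaves (deriv_formula x F) \<le> leaves F"
  by (induction F) auto

lemma leaves_pos: "0 < leaves F"
  by (induction F) auto

lemma evalf_perturb:
  "evalf F (perturb x y) = (if beval (deriv_formula x F) y then Unst else stable (beval F x))"
  by (induction F) (auto simp: perturb_def stable_def tand_def tor_def)

text \<open>Hazard-freeness turns the instability of the formula at \<open>perturb x y\<close> into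
  that of \<open>f\<close>.\<close>

lemma computes_deriv_formula:
  assumes "hazard_free_for F f"
  shows "computes (deriv_formula x F) (hderiv f x)"
proof -
  have "hderiv f x y \<longleftrightarrow> beval (deriv_formula x F) y" for y
    using assms evalf_perturb [of F x y]
    by (auto simp: hderiv_def hazard_free_for_def stable_def split: if_splits)
  then show ?thesis by (auto simp: computes_iff_beval)
qed

text \<open>A discarded input costs at least one leaf (\<open>leaves_pos\<close>), so equality
  forces the inputs of every gate to agree at \<open>x\<close>. Complementing by this common value
  exchanges AND and OR exactly as \<open>deriv_formula\<close> does.\<close>

lemma beval_shift_if_leaves_eq:
  assumes "leaves (deriv_formula x F) = leaves F"
  shows "beval F (\<lambda>i. x i \<noteq> y i) \<longleftrightarrow> beval F x \<noteq> beval (deriv_formula x F) y"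
  using assms
proof (induction F)
  case (FAnd F G)
  with leaves_deriv_formula_le [of x F] leaves_deriv_formula_le [of x G]
    leaves_pos [of F] leaves_pos [of G]
  show ?case by (auto split: if_splits)
next
  case (FOr F G)
  with leaves_deriv_formula_le [of x F] leaves_deriv_formula_le [of x G]
    leaves_pos [of F] leaves_pos [of G]
  show ?case by (auto split: if_splits)
qed auto

text \<open>In simp normal form: shifting twice by the same point is the identity.\<close>

lemma eq_eq_cancel [simp]: "(a = (a = b)) \<longleftrightarrow> b"
  by (cases a) simp_all

text \<open>Up to a complement when \<open>f x\<close> holds, \<open>f\<close> is \<open>g\<close>
  read in coordinates flipped by \<open>x\<close>; hence \<open>x i\<close> and \<open>f x\<close>
  decide the direction at \<open>i\<close>.\<close>

lemma unate_if_mono_shift: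
  assumes shift: "\<And>y. f (\<lambda>i. x i \<noteq> y i) \<longleftrightarrow> f x \<noteq> g y" and "mono g"
  shows "unate f"
  unfolding unate_def
proof
  fix i
  have f_eq: "f z \<longleftrightarrow> f x \<noteq> g (\<lambda>i. x i \<noteq> z i)" for z
    using shift [of "\<lambda>i. x i \<noteq> z i"] by simp
  define s where "s z b = (\<lambda>j. x j \<noteq> (z(i := b)) j)" for z b
  \<comment> \<open>At \<open>i\<close> the left point is False and the right one True; elsewhere
    they agree.\<close>
  have "s z (x i) \<le> s z (\<not> x i)" for z
    by (auto simp: s_def le_fun_def)
  then have le: "g (s z (x i)) \<le> g (s z (\<not> x i))" for z
    by (rule monoD [OF \<open>mono g\<close>])
  have eq: "f (z(i := b)) \<longleftrightarrow> f x \<noteq> g (s z b)" for z b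
    unfolding s_def by (rule f_eq)
  show "positive_unate_in f i \<or> negative_unate_in f i"
    using le unfolding positive_unate_in_def negative_unate_in_def eq
    by (cases "x i"; cases "f x") auto
qed

section \<open>Existence of hazard-free formulas\<close>

text \<open>Makes the set of all implicants finite, so that their disjunction is a formula.\<close>

instance tern :: finite
proof
  have "UNIV = {Zero, Unst, One}" using tern.exhaust by blast
  then show "finite (UNIV :: tern set)" by (metis finite.emptyI finite.insertI)
qed

text \<open>The conditions for One and Zero together determine the ternary value. An empty
  conjunction would need a constant leaf.\<close>

lemma finite_conjunction:
  assumes "finite A" "A \<noteq> {}"
  shows "\<exists>F. \<forall>x. (evalf F x = One \<longleftrightarrow> (\<forall>G\<in>A. evalf G x = One)) \<and>
                 (evalf F x = Zero \<longleftrightarrow> (\<exists>G\<in>A. evalf G x = Zero))"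
  using assms
proof (induction A rule: finite_ne_induct)
  case (singleton G)
  then show ?case by auto
next
  case (insert G A)
  then obtain F where "\<forall>x. (evalf F x = One \<longleftrightarrow> (\<forall>G\<in>A. evalf G x = One)) \<and>
    (evalf F x = Zero \<longleftrightarrow> (\<exists>G\<in>A. evalf G x = Zero))" by blast
  then show ?case by (intro exI [of _ "FAnd G F"]) (auto simp: tand_def)
qed

lemma finite_disjunction:
  assumes "finite A" "A \<noteq> {}"
  shows "\<exists>F. \<forall>x. (evalf F x = One \<longleftrightarrow> (\<exists>G\<in>A. evalf G x = One)) \<and>
                 (evalf F x = Zero \<longleftrightarrow> (\<forall>G\<in>A. evalf G x = Zero))"
  using assms
proof (induction A rule: finite_ne_induct)
  case (singleton G)
  then show ?case by auto
next
  case (insert G A)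
  then obtain F where "\<forall>x. (evalf F x = One \<longleftrightarrow> (\<exists>G\<in>A. evalf G x = One)) \<and>
    (evalf F x = Zero \<longleftrightarrow> (\<forall>G\<in>A. evalf G x = Zero))" by blast
  then show ?case by (intro exI [of _ "FOr G F"]) (auto simp: tor_def)
qed

lemma tneg_eq_iff [simp]: "tneg a = One \<longleftrightarrow> a = Zero" "tneg a = Zero \<longleftrightarrow> a = One"
  by (cases a; simp)+

text \<open>The witness is the conjunction of the literals prescribed by the stable coordinates of
  \<open>t\<close>.\<close>

lemma term_formula:
  fixes t :: "'n::finite \<Rightarrow> tern"
  assumes "\<exists>i. t i \<noteq> Unst"
  shows "\<exists>F. \<forall>x. (evalf F x = One \<longleftrightarrow> (\<forall>i. t i \<noteq> Unst \<longrightarrow> x i = t i)) \<and>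
                 (evalf F x = Zero \<longleftrightarrow> (\<exists>i. t i \<noteq> Unst \<and> x i = tneg (t i)))"
proof -
  define lit where "lit i = (if t i = One then FVar i else FNot (FVar i))" for i
  have lit: "evalf (lit i) x = One \<longleftrightarrow> x i = t i" "evalf (lit i) x = Zero \<longleftrightarrow> x i = tneg (t i)"
    if "t i \<noteq> Unst" for i x
    using that by (cases "t i"; simp add: lit_def)+
  show ?thesis
    using finite_conjunction [of "lit ` {i. t i \<noteq> Unst}"] assms by (auto simp: lit)
qed

lemma hf_ext_One_iff: "hf_ext f x = One \<longleftrightarrow> (\<forall>y\<in>resolutions x. f y)"
  by (simp add: hf_ext_def)

lemma resolutions_nonempty: "\<exists>y. y \<in> resolutions x"
  by (rule exI [of _ "\<lambda>i. x i = One"], unfold resolutions_def stable_def)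
    (auto, metis tern.exhaust)

text \<open>\<open>hf_ext\<close> tests for One first, so a vacuous quantifier has to be
  excluded.\<close>

lemma hf_ext_Zero_iff: "hf_ext f x = Zero \<longleftrightarrow> (\<forall>y\<in>resolutions x. \<not> f y)"
  using resolutions_nonempty [of x] by (auto simp: hf_ext_def)

lemma tern_eqI: "(a = One \<longleftrightarrow> b = One) \<Longrightarrow> (a = Zero \<longleftrightarrow> b = Zero) \<Longrightarrow> a = b"
  by (cases a; cases b; simp)

text \<open>Without a clash, setting to 1 exactly the coordinates where \<open>t\<close> or
  \<open>x\<close> demands it respects every demanded 0.\<close>

lemma common_resolution:
  assumes "\<not> (\<exists>i. t i \<noteq> Unst \<and> x i = tneg (t i))"
  shows "\<exists>y. y \<in> resolutions t \<and> y \<in> resolutions x"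
proof -
  have "(\<lambda>i. t i = One \<or> x i = One) \<in> resolutions t \<inter> resolutions x"
    unfolding resolutions_def
  proof (intro IntI CollectI allI impI)
    fix i
    show "stable (t i = One \<or> x i = One) = t i" if "t i \<noteq> Unst"
      using assms that by (cases "t i"; cases "x i") (auto simp: stable_def dest!: spec [of _ i])
    show "stable (t i = One \<or> x i = One) = x i" if "x i \<noteq> Unst"
      using assms that by (cases "t i"; cases "x i") (auto simp: stable_def dest!: spec [of _ i])
  qed
  then show ?thesis by blast
qed

text \<open>The disjunction of \<^emph>\<open>all\<close> implicants, not just of enough of them to cover \<open>f\<close>, is
  hazard-free: if \<open>f\<close> is constantly 1 on the resolutions of \<open>x\<close>, then \<open>x\<close> is itself an implicant.\<close>

lemma ex_hazard_free:
  fixes f :: "('n::finite \<Rightarrow> bool) \<Rightarrow> bool"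
  assumes nonconst: "\<not> (\<exists>c. \<forall>x. f x = c)"
  shows "\<exists>F. hazard_free_for F f"
proof -
  define I where "I = {t. hf_ext f t = One}"
  obtain y1 y0 where y: "f y1" "\<not> f y0" using nonconst by blast
  \<comment> \<open>An implicant with no stable coordinate would have the zero \<open>y0\<close> of
    \<open>f\<close> among its resolutions.\<close>
  have "\<exists>i. t i \<noteq> Unst" if "t \<in> I" for t
  proof (rule ccontr)
    assume "\<not> ?thesis"
    then have "y0 \<in> resolutions t" by (auto simp: resolutions_def)
    with that y show False by (auto simp: I_def hf_ext_One_iff)
  qed
  then have "\<forall>t\<in>I. \<exists>F. \<forall>x. (evalf F x = One \<longleftrightarrow> (\<forall>i. t i \<noteq> Unst \<longrightarrow> x i = t i)) \<and>
      (evalf F x = Zero \<longleftrightarrow> (\<exists>i. t i \<noteq> Unst \<and> x i = tneg (t i)))"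
    by (intro ballI term_formula)
  from bchoice [OF this] obtain T where "\<forall>t\<in>I. \<forall>x.
      (evalf (T t) x = One \<longleftrightarrow> (\<forall>i. t i \<noteq> Unst \<longrightarrow> x i = t i)) \<and>
      (evalf (T t) x = Zero \<longleftrightarrow> (\<exists>i. t i \<noteq> Unst \<and> x i = tneg (t i)))" ..
  then have T: "(evalf (T t) x = One \<longleftrightarrow> (\<forall>i. t i \<noteq> Unst \<longrightarrow> x i = t i)) \<and>
      (evalf (T t) x = Zero \<longleftrightarrow> (\<exists>i. t i \<noteq> Unst \<and> x i = tneg (t i)))" if "t \<in> I" for t x
    using that by blast
  have stable_I: "(\<lambda>i. stable (y i)) \<in> I" if "f y" for y
    using that by (simp add: I_def hf_ext_stable)
  then have "T ` I \<noteq> {}" using y by blast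
  then have "\<exists>F. \<forall>x. (evalf F x = One \<longleftrightarrow> (\<exists>G\<in>T ` I. evalf G x = One)) \<and>
      (evalf F x = Zero \<longleftrightarrow> (\<forall>G\<in>T ` I. evalf G x = Zero))"
    by (intro finite_disjunction) simp_all
  then obtain F where F: "\<And>x. (evalf F x = One \<longleftrightarrow> (\<exists>t\<in>I. evalf (T t) x = One)) \<and>
      (evalf F x = Zero \<longleftrightarrow> (\<forall>t\<in>I. evalf (T t) x = Zero))"
    unfolding ball_simps bex_simps by blast
  have "evalf F x = hf_ext f x" for x
  proof (rule tern_eqI)
    have "hf_ext f x = One" if t: "t \<in> I" "evalf (T t) x = One" for t
    proof -
      have "resolutions x \<subseteq> resolutions t"
        using t T [OF t(1)] by (auto simp: resolutions_def)
      then show ?thesis using t(1) by (auto simp: I_def hf_ext_One_iff)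
    qed
    moreover have "evalf (T x) x = One" if "hf_ext f x = One"
      using T [of x x] that by (simp add: I_def)
    ultimately show "evalf F x = One \<longleftrightarrow> hf_ext f x = One"
      using F [of x] by (auto simp: I_def)
    \<comment> \<open>On a common resolution \<open>f\<close> would be both true and false, so
      \<open>t\<close> and \<open>x\<close> clash at some coordinate.\<close>
    have "evalf (T t) x = Zero" if "t \<in> I" "hf_ext f x = Zero" for t
    proof -
      have "\<not> (\<exists>y. y \<in> resolutions t \<and> y \<in> resolutions x)"
        using that by (auto simp: I_def hf_ext_One_iff hf_ext_Zero_iff)
      then show ?thesis
        using common_resolution [of t x] T [OF that(1), of x] by blast
    qed
    \<comment> \<open>The minterm of a true resolution \<open>r\<close> is an implicant; it cannot
      clash with \<open>x\<close>, because \<open>r\<close> resolves \<open>x\<close>.\<close>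
    moreover have False
      if all0: "\<And>t. t \<in> I \<Longrightarrow> evalf (T t) x = Zero" and r: "r \<in> resolutions x" "f r" for r
    proof -
      have "(\<lambda>i. stable (r i)) \<in> I" using stable_I r by blast
      with T all0 obtain i where "x i = tneg (stable (r i))" by blast
      with r(1) show False
        unfolding resolutions_def by (cases "r i") (auto simp: stable_def dest: spec [of _ i])
    qed
    ultimately show "evalf F x = Zero \<longleftrightarrow> hf_ext f x = Zero"
      using F [of x] by (auto simp: hf_ext_Zero_iff)
  qed
  then show ?thesis by (auto simp: hazard_free_for_def)
qed

section \<open>Unate functions\<close>

text \<open>AND and OR commute with rounding \<open>Unst\<close> down to 0 and with rounding it up
  to 1, so two Boolean evaluations determine the ternary value.\<close>

lemma evalf_negation_free:
  assumes "negation_free F"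
  shows "(evalf F w = One \<longleftrightarrow> beval F (\<lambda>i. w i = One)) \<and>
         (evalf F w = Zero \<longleftrightarrow> \<not> beval F (\<lambda>i. w i \<noteq> Zero))"
  using assms by (induction F) (auto simp: tand_def tor_def)

text \<open>The shift is done by negations at the leaves, which the size does not count.\<close>

primrec shift_formula :: "('n \<Rightarrow> bool) \<Rightarrow> 'n formula \<Rightarrow> 'n formula" where
  "shift_formula x (FVar i) = (if x i then FNot (FVar i) else FVar i)"
| "shift_formula x (FNot F) = FNot (shift_formula x F)"
| "shift_formula x (FAnd F G) = FAnd (shift_formula x F) (shift_formula x G)"
| "shift_formula x (FOr F G) = FOr (shift_formula x F) (shift_formula x G)"

lemma leaves_shift_formula [simp]: "leaves (shift_formula x F) = leaves F"
  by (induction F) auto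

lemma evalf_shift_formula:
  "evalf (shift_formula x F) z = evalf F (\<lambda>i. if x i then tneg (z i) else z i)"
  by (induction F) auto

text \<open>In shifted coordinates the resolutions of \<open>z\<close> have a least point
  \<open>lo\<close> and a greatest point \<open>hi\<close>. By monotonicity these two decide
  \<open>hf_ext f z\<close>, and by \<open>evalf_negation_free\<close> they also decide the value of
  the formula.\<close>

lemma hazard_free_shift_formula:
  assumes "negation_free F" and f: "\<And>z. f z = beval F (\<lambda>i. x i \<noteq> z i)"
  shows "hazard_free_for (shift_formula x F) f"
  unfolding hazard_free_for_def
proof
  fix z :: "'a \<Rightarrow> tern"
  define w where "w = (\<lambda>i. if x i then tneg (z i) else z i)"
  define lo where "lo = (\<lambda>i. w i = One)"
  define hi where "hi = (\<lambda>i. w i \<noteq> Zero)"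
  have mono: "beval F a \<Longrightarrow> a \<le> b \<Longrightarrow> beval F b" for a b
    using mono_beval [OF assms(1)] by (auto simp: mono_def)
  have bounds: "lo \<le> (\<lambda>i. x i \<noteq> r i)" "(\<lambda>i. x i \<noteq> r i) \<le> hi" if "r \<in> resolutions z" for r
    using that unfolding resolutions_def lo_def hi_def w_def le_fun_def
    by (auto simp: stable_def split: if_splits) (metis tern.distinct)+
  have res: "(\<lambda>i. x i \<noteq> lo i) \<in> resolutions z" "(\<lambda>i. x i \<noteq> hi i) \<in> resolutions z"
    unfolding resolutions_def lo_def hi_def w_def
    by (auto simp: stable_def) (metis tern.exhaust)+
  have ends: "f (\<lambda>i. x i \<noteq> lo i) = beval F lo" "f (\<lambda>i. x i \<noteq> hi i) = beval F hi"
    by (simp_all add: f)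
  have "f r" if "beval F lo" "r \<in> resolutions z" for r
    unfolding f using that(1) bounds(1) [OF that(2)] by (rule mono)
  then have "hf_ext f z = One \<longleftrightarrow> beval F lo"
    using res(1) ends(1) unfolding hf_ext_One_iff by blast
  moreover have "beval F hi" if "f r" "r \<in> resolutions z" for r
    using that(1) [unfolded f] bounds(2) [OF that(2)] by (rule mono)
  then have "hf_ext f z = Zero \<longleftrightarrow> \<not> beval F hi"
    using res(2) ends(2) unfolding hf_ext_Zero_iff by blast
  ultimately show "evalf (shift_formula x F) z = hf_ext f z"
    using evalf_negation_free [OF assms(1), of w] tern_eqI
    by (auto simp: evalf_shift_formula w_def [symmetric] lo_def hi_def)
qed

lemma mono_if_mono_coordinatewise:
  fixes h :: "('n::finite \<Rightarrow> bool) \<Rightarrow> bool"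
  assumes "\<And>i y. h (y(i := False)) \<le> h (y(i := True))"
  shows "mono h"
proof (rule monoI)
  have step: "h y \<Longrightarrow> h (y(i := True))" for i y
    using assms [of y i] by (cases "y i") (auto simp: fun_upd_idem)
  \<comment> \<open>Moves up one coordinate at a time; finiteness of the index type lets this reach
    any larger point.\<close>
  have raise: "h (\<lambda>i. i \<in> A \<or> y i)" if "finite A" "h y" for A y
    using that
  proof (induction A rule: finite_induct)
    case (insert a A)
    have "(\<lambda>i. i \<in> insert a A \<or> y i) = (\<lambda>i. i \<in> A \<or> y i)(a := True)" by auto
    then show ?case using insert step by metis
  qed simp
  fix y y' :: "'n \<Rightarrow> bool"
  assume "y \<le> y'"
  then have "(\<lambda>i. i \<in> {i. y' i} \<or> y i) = y'" by (auto simp: le_fun_def)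
  then show "h y \<le> h y'" using raise [of "{i. y' i}" y] by auto
qed

lemma resolutions_perturb: "resolutions (perturb x y) = {r. \<forall>i. y i \<or> r i = x i}"
proof -
  have "stable b \<noteq> Unst" for b by (simp add: stable_def)
  then show ?thesis by (auto simp: resolutions_def perturb_def)
qed

lemma hderiv_iff: "hderiv f x y \<longleftrightarrow> (\<exists>r. (\<forall>i. y i \<or> r i = x i) \<and> f r \<noteq> f x)"
proof -
  have "x \<in> resolutions (perturb x y)" by (simp add: resolutions_perturb)
  then have "hderiv f x y \<longleftrightarrow> (\<exists>r\<in>resolutions (perturb x y). f r \<noteq> f x)"
    by (cases "f x") (auto simp: hderiv_def hf_ext_def)
  then show ?thesis by (auto simp: resolutions_perturb)
qed

lemma unate_hderiv_eq_shift:
  fixes f :: "('n::finite \<Rightarrow> bool) \<Rightarrow> bool"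
  assumes "unate f" "\<not> f z"
  shows "\<exists>x. \<forall>z. f z = hderiv f x (\<lambda>i. x i \<noteq> z i)"
proof -
  \<comment> \<open>Each coordinate gets the value less favourable to \<open>f\<close>: 0 if
    \<open>f\<close> is positive unate there, otherwise 1, where unateness gives the negative
    direction.\<close>
  define x where "x = (\<lambda>i. \<not> positive_unate_in f i)"
  define h where "h y = f (\<lambda>i. x i \<noteq> y i)" for y
  have f_eq: "f z = h (\<lambda>i. x i \<noteq> z i)" for z by (simp add: h_def)
  have upd: "h (y(i := b)) = f ((\<lambda>j. x j \<noteq> y j)(i := (x i \<noteq> b)))" for y i b
    unfolding h_def by (rule arg_cong [of _ _ f]) (auto simp: fun_eq_iff)
  have "h (y(i := False)) \<le> h (y(i := True))" for i y
    unfolding upd using \<open>unate f\<close>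
    by (cases "x i") (auto simp: x_def unate_def positive_unate_in_def negative_unate_in_def)
  then have "mono h" by (rule mono_if_mono_coordinatewise)
  then have mono: "h a \<Longrightarrow> a \<le> b \<Longrightarrow> h b" for a b by (auto simp: mono_def)
  \<comment> \<open>A monotone \<open>h\<close> true at its bottom would be true everywhere, against
    the zero \<open>z\<close> of \<open>f\<close>.\<close>
  have "\<not> h (\<lambda>i. False)"
  proof
    assume "h (\<lambda>i. False)"
    then have "h (\<lambda>i. x i \<noteq> z i)" by (rule mono) (simp add: le_fun_def)
    with \<open>\<not> f z\<close> f_eq [of z] show False by simp
  qed
  then have "\<not> f x" by (simp add: h_def)
  have "hderiv f x y = h y" for y
  proof
    assume "hderiv f x y"
    then obtain r where r: "\<forall>i. y i \<or> r i = x i" "f r"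
      using \<open>\<not> f x\<close> unfolding hderiv_iff by blast
    from r(1) have "(\<lambda>i. x i \<noteq> r i) \<le> y"
      unfolding le_fun_def le_bool_def by metis
    with r(2) show "h y" unfolding f_eq by (rule mono)
  next
    \<comment> \<open>The witness flips every coordinate that \<open>y\<close> allows, the most
      favourable choice for the monotone \<open>h\<close>.\<close>
    assume "h y"
    with \<open>\<not> f x\<close> show "hderiv f x y"
      unfolding hderiv_iff h_def by (intro exI [of _ "\<lambda>i. x i \<noteq> y i"]) auto
  qed
  then show ?thesis using f_eq by auto
qed

section \<open>Minimum sizes\<close>

lemma size_F_u_le: "hazard_free_for F f \<Longrightarrow> size_F_u f \<le> leaves F"
  unfolding size_F_u_def by (rule Least_le) blast

lemma size_F_plus_le: "negation_free F \<Longrightarrow> computes F g \<Longrightarrow> size_F_plus g \<le> leaves F"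
  unfolding size_F_plus_def by (rule Least_le) blast

lemma size_F_u_attained:
  assumes "\<exists>F. hazard_free_for F f"
  shows "\<exists>F. hazard_free_for F f \<and> leaves F = size_F_u f"
  unfolding size_F_u_def
  by (rule LeastI_ex [of "\<lambda>s. \<exists>F. hazard_free_for F f \<and> leaves F = s"]) (use assms in blast)

lemma size_F_plus_attained:
  assumes "\<exists>F. negation_free F \<and> computes F g"
  shows "\<exists>F. negation_free F \<and> computes F g \<and> leaves F = size_F_plus g"
  unfolding size_F_plus_def
  by (rule LeastI_ex [of "\<lambda>s. \<exists>F. negation_free F \<and> computes F g \<and> leaves F = s"])
    (use assms in blast)

theorem theorem1p26:
  fixes f :: "('n::finite \<Rightarrow> bool) \<Rightarrow> bool"
  assumes nonconst: "\<not> (\<exists>c. \<forall>x. f x = c)"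
  shows "(\<exists>x. size_F_plus (hderiv f x) = size_F_u f) \<longleftrightarrow> unate f"
proof -
  \<comment> \<open>Existence of a hazard-free formula is what makes \<open>size_F_u f\<close> an
    attained minimum.\<close>
  obtain F where F: "hazard_free_for F f" "leaves F = size_F_u f"
    using size_F_u_attained [OF ex_hazard_free [OF nonconst]] by blast
  have deriv: "negation_free (deriv_formula x F)" "computes (deriv_formula x F) (hderiv f x)" for x
    using negation_free_deriv_formula computes_deriv_formula [OF F(1)] by blast+
  have le: "size_F_plus (hderiv f x) \<le> leaves (deriv_formula x F)" for x
    using deriv by (rule size_F_plus_le)
  show ?thesis
  proof
    assume "\<exists>x. size_F_plus (hderiv f x) = size_F_u f"
    then obtain x where "size_F_plus (hderiv f x) = leaves F" using F(2) by auto
    \<comment> \<open>The chain from \<open>size_F_plus\<close> through the derived formula to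
      \<open>leaves F\<close> collapses to equalities.\<close>
    then have "leaves (deriv_formula x F) = leaves F"
      using le [of x] leaves_deriv_formula_le [of x F] by simp
    from beval_shift_if_leaves_eq [OF this]
    show "unate f"
      using unate_if_mono_shift mono_beval [OF deriv(1)] hazard_free_for_beval [OF F(1)] by metis
  next
    assume "unate f"
    with nonconst obtain x where x: "\<And>z. f z = hderiv f x (\<lambda>i. x i \<noteq> z i)"
      using unate_hderiv_eq_shift by metis
    \<comment> \<open>A minimal formula for the derivative, shifted by \<open>x\<close>, becomes a
      hazard-free formula for \<open>f\<close> with as many leaves.\<close>
    obtain G where G: "negation_free G" "computes G (hderiv f x)"
      "leaves G = size_F_plus (hderiv f x)"
      using size_F_plus_attained deriv by blast
    then have "hazard_free_for (shift_formula x G) f"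
      using x by (intro hazard_free_shift_formula) (auto simp: computes_iff_beval)
    then have "size_F_u f \<le> size_F_plus (hderiv f x)"
      using size_F_u_le G(3) by fastforce
    moreover have "size_F_plus (hderiv f x) \<le> size_F_u f"
      using le [of x] leaves_deriv_formula_le [of x F] F(2) by simp
    ultimately show "\<exists>x. size_F_plus (hderiv f x) = size_F_u f" by (metis le_antisym)
  qed
qed

end
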